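(* There is an absolute constant $c_0>0$ such that for every constant $c_6\ge c_0$ the following holds. Let $\psi\in(0,1)$, let $n\ge1/\psi$ be an integer, and let $G$ be the graph with vertex set $[n]$ in which two distinct vertices $i,j$ are adjacent if and only if $|i-j|\le\lceil (c_6/\psi)\log n\rceil$ (so $G$ has at most $n\lceil (c_6/\psi)\log n\rceil$ edges). Then $\mathbb E_{H\sim\mathcal D(G,\psi)}[f(H)]\le\ell(n,\psi)+1$.
   Context: $[n]=\{1,\dots,n\}$ and $K_n$ is the complete graph on $[n]$. For a graph $G$ with vertex set $[n]$ and $i<j$, a straight path from $i$ to $j$ in $G$ is a path $i=i_1<i_2<\dots<i_m=j$ all of whose consecutive pairs are edges of $G$. The deficiency $f(G)$ is the number of pairs $i<j$ in $[n]$ with no straight path from $i$ to $j$ in $G$. $\mathcal D(G,\psi)$ is the distribution of the random subgraph of $G$ (same vertex set) in which each edge of $G$ is kept independently with probability $\psi$. The optimal deficiency is $\ell(n,\psi)=\mathbb E_{H\sim\mathcal D(K_n,\psi)}[f(H)]$. *)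

theory Defs
  imports "HOL-Probability.Probability"
begin

text \<open>
  A simple graph with vertex set \<open>{1..n}\<close> is represented by its set of edges, each edge being
  an unordered pair \<open>{i, j}\<close> with \<open>i \<noteq> j\<close>; the number \<open>n\<close> is passed separately where it matters.
\<close>

definition complete_edges :: "nat \<Rightarrow> nat set set" where
  "complete_edges n = {{i, j} | i j. i \<in> {1..n} \<and> j \<in> {1..n} \<and> i \<noteq> j}"

definition straight_path :: "nat set set \<Rightarrow> nat \<Rightarrow> nat \<Rightarrow> nat list \<Rightarrow> bool" where
  "straight_path E i j p \<longleftrightarrow>
     p \<noteq> [] \<and> hd p = i \<and> last p = j \<and> sorted_wrt (<) p \<and> successively (\<lambda>u v. {u, v} \<in> E) p"

definition deficiency :: "nat \<Rightarrow> nat set set \<Rightarrow> nat" where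
  "deficiency n E =
     card {(i, j). i \<in> {1..n} \<and> j \<in> {1..n} \<and> i < j \<and> \<not> (\<exists>p. straight_path E i j p)}"

text \<open>The edge set \<open>E\<close> is meant to be finite, since \<^const>\<open>Pi_pmf\<close> is only a product then.\<close>

definition random_subgraph :: "nat set set \<Rightarrow> real \<Rightarrow> nat set set pmf" where
  "random_subgraph E \<psi> =
     map_pmf (\<lambda>kept. {e \<in> E. kept e}) (Pi_pmf E False (\<lambda>_. bernoulli_pmf \<psi>))"

definition expected_deficiency :: "nat \<Rightarrow> nat set set \<Rightarrow> real \<Rightarrow> real" where
  "expected_deficiency n E \<psi> =
     measure_pmf.expectation (random_subgraph E \<psi>) (\<lambda>H. real (deficiency n H))"

definition optimal_deficiency :: "nat \<Rightarrow> real \<Rightarrow> real" where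
  "optimal_deficiency n \<psi> = expected_deficiency n (complete_edges n) \<psi>"

definition band_edges :: "nat \<Rightarrow> int \<Rightarrow> nat set set" where
  "band_edges n w =
     {{i, j} | i j. i \<in> {1..n} \<and> j \<in> {1..n} \<and> i \<noteq> j \<and> \<bar>int i - int j\<bar> \<le> w}"

end

theory Submission
  imports Defs
begin

text \<open>
  Couple the two random graphs by intersecting a random subgraph of the complete graph with the
  band of width \<open>W\<close>. Pairs at distance at most \<open>W\<close> are not affected by this, so it suffices that a
  pair \<open>i < j\<close> at larger distance is disconnected in the band with probability at most \<open>1 / n^2\<close>.
  Explore the vertices to the right of \<open>i\<close> one by one: if \<open>r\<close> of those seen so far are reachable, the
  next one is unreachable with probability \<open>(1 - p)^r\<close>. Then \<open>(1 - p)^r / r\<close> shrinks in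
  expectation by a factor \<open>1 - p / 2\<close> per step, and hence the vertex \<open>i + t + 1\<close> is unreachable with
  probability at most \<open>n (1 - p / 2)^t\<close>. With \<open>k = W div 2\<close>, this makes all vertices in
  \<open>{i + k<..i + W}\<close> reachable with high probability, and beyond \<open>i + W\<close> reachability propagates as
  soon as every vertex has an edge to one of the \<open>k\<close> vertices before it.
\<close>

text \<open>Orienting every edge upwards turns straight paths into a reflexive-transitive closure,
  so that induction on reachability replaces work with lists.\<close>

definition up_edge :: "nat set set \<Rightarrow> nat \<Rightarrow> nat \<Rightarrow> bool" where
  "up_edge E u v \<longleftrightarrow> u < v \<and> {u, v} \<in> E"

abbreviation reach :: "nat set set \<Rightarrow> nat \<Rightarrow> nat \<Rightarrow> bool" where
  "reach E \<equiv> (up_edge E)\<^sup>*\<^sup>*"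

definition reach_set :: "nat set set \<Rightarrow> nat \<Rightarrow> nat \<Rightarrow> nat set" where
  "reach_set E i m = {v \<in> {i..m}. reach E i v}"

text \<open>Used with \<open>v = Suc m\<close>: the edges gained when the vertex
  \<open>Suc m\<close> joins the complete graph on \<open>{1..m}\<close>.\<close>

definition star_edges :: "nat \<Rightarrow> nat \<Rightarrow> nat set set" where
  "star_edges m v = (\<lambda>u. {u, v}) ` {1..m}"

subsection \<open>Straight paths as reachability\<close>

lemma reach_le: "reach E i j \<Longrightarrow> i \<le> j"
  by (induction rule: rtranclp_induct) (auto simp: up_edge_def)

lemma reach_imp_straight_path:
  assumes "reach E i j"
  shows "\<exists>p. straight_path E i j p"
  using assms
proof (induction rule: rtranclp_induct)
  case base
  have "straight_path E i i [i]" by (simp add: straight_path_def)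
  then show ?case ..
next
  case (step y z)
  then obtain p where p: "straight_path E i y p" by blast
  \<comment> \<open>The list is increasing and ends in \<open>y\<close>, so appending the larger
    vertex \<open>z\<close> keeps it increasing.\<close>
  then have "\<forall>x\<in>set p. x \<le> y"
    unfolding straight_path_def
    by (metis append_butlast_last_id in_set_conv_decomp_last order.strict_implies_order
        order_refl rotate1.simps(2) set_ConsD set_rotate1 sorted_wrt_append list.set_intros(1))
  with p step(2) have "straight_path E i z (p @ [z])"
    by (auto simp: straight_path_def sorted_wrt_append successively_append_iff up_edge_def)
  then show ?case ..
qed

lemma straight_path_imp_reach:
  assumes "straight_path E i j p"
  shows "reach E i j"
  using assms
proof (induction p arbitrary: i)
  case Nil
  then show ?case by (simp add: straight_path_def)
next
  case (Cons a p)
  show ?case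
  proof (cases p)
    case Nil
    with Cons.prems show ?thesis by (auto simp: straight_path_def)
  next
    case (Cons b q)
    with Cons.prems have "up_edge E i b" "straight_path E b j p"
      by (auto simp: straight_path_def up_edge_def)
    with Cons.IH show ?thesis by (meson converse_rtranclp_into_rtranclp)
  qed
qed

lemma straight_path_iff_reach: "(\<exists>p. straight_path E i j p) \<longleftrightarrow> reach E i j"
  using reach_imp_straight_path straight_path_imp_reach by blast

lemma deficiency_altdef:
  "deficiency n E = card {(i, j). i \<in> {1..n} \<and> j \<in> {1..n} \<and> i < j \<and> \<not> reach E i j}"
  by (simp add: deficiency_def straight_path_iff_reach)

text \<open>Upward paths from \<open>i\<close> to \<open>j\<close> never leave the interval from
  \<open>i\<close> to \<open>j\<close>, so only edges inside it matter. This serves both for cutting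
  down to the band and for ignoring later vertices.\<close>

lemma reach_restrict:
  assumes "reach E i j"
    and "\<And>u v. i \<le> u \<Longrightarrow> u < v \<Longrightarrow> v \<le> j \<Longrightarrow> {u, v} \<in> E \<Longrightarrow> {u, v} \<in> F"
  shows "reach F i j"
  using assms
proof (induction rule: rtranclp_induct)
  case (step y z)
  then have "i \<le> y" "y < z" "{y, z} \<in> E"
    using reach_le by (auto simp: up_edge_def)
  with step.prems have "up_edge F y z" by (simp add: up_edge_def)
  moreover have "reach F i y"
    using step.prems \<open>y < z\<close> by (intro step.IH) auto
  ultimately show ?case by (metis rtranclp.rtrancl_into_rtrancl)
qed simp

lemma reach_mono: "reach E i j \<Longrightarrow> E \<subseteq> F \<Longrightarrow> reach F i j"
  by (erule reach_restrict) auto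

lemma finite_reach_set [simp]: "finite (reach_set E i m)"
  by (simp add: reach_set_def)

lemma card_reach_set_le: "i \<ge> 1 \<Longrightarrow> card (reach_set E i m) \<le> m"
  using card_mono[of "{1..m}" "reach_set E i m"] by (fastforce simp: reach_set_def)

lemma card_reach_set_pos: "i \<le> m \<Longrightarrow> card (reach_set E i m) > 0"
  by (auto simp: card_gt_0_iff reach_set_def)

section \<open>Extending the complete graph by one vertex\<close>

lemma complete_edges_memI: "1 \<le> u \<Longrightarrow> u < v \<Longrightarrow> v \<le> n \<Longrightarrow> {u, v} \<in> complete_edges n"
  unfolding complete_edges_def by fastforce

lemma finite_complete_edges [simp]: "finite (complete_edges n)"
  by (rule finite_subset[of _ "Pow {1..n}"]) (auto simp: complete_edges_def)

lemma finite_star_edges [simp]: "finite (star_edges m v)"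
  by (simp add: star_edges_def)

lemma complete_edges_Suc: "complete_edges (Suc m) = complete_edges m \<union> star_edges m (Suc m)"
proof (intro set_eqI iffI)
  fix e assume "e \<in> complete_edges (Suc m)"
  then obtain i j where e: "e = {i, j}" and ij: "i \<noteq> j" "1 \<le> i" "1 \<le> j" "i \<le> Suc m" "j \<le> Suc m"
    by (auto simp: complete_edges_def)
  consider "i = Suc m" | "j = Suc m" | "i \<le> m" "j \<le> m" using ij by linarith
  then show "e \<in> complete_edges m \<union> star_edges m (Suc m)"
  proof cases
    case 1
    then have "e = {j, Suc m}" "j \<in> {1..m}" using e ij by auto
    then show ?thesis by (auto simp: star_edges_def)
  next
    case 2
    then have "e = {i, Suc m}" "i \<in> {1..m}" using e ij by auto
    then show ?thesis by (auto simp: star_edges_def)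
  next
    case 3
    then show ?thesis using e ij by (auto simp: complete_edges_def)
  qed
next
  fix e assume "e \<in> complete_edges m \<union> star_edges m (Suc m)"
  then show "e \<in> complete_edges (Suc m)"
    by (fastforce simp: complete_edges_def star_edges_def)
qed

lemma complete_star_disjoint: "complete_edges m \<inter> star_edges m (Suc m) = {}"
  by (auto simp: complete_edges_def star_edges_def doubleton_eq_iff)

lemma complete_edges_mono: "m \<le> n \<Longrightarrow> complete_edges m \<subseteq> complete_edges n"
  by (fastforce simp: complete_edges_def)

text \<open>The last edge into \<open>Suc m\<close> must lie in \<open>H2\<close>, and everything
  before it in \<open>H1\<close>. This separates the explored part from the fresh edges, which are
  independent of it.\<close>

lemma reach_Suc_iff:
  assumes "H1 \<subseteq> complete_edges m" "H2 \<subseteq> star_edges m (Suc m)" "i \<le> m"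
  shows "reach (H1 \<union> H2) i (Suc m) \<longleftrightarrow> (\<exists>u\<in>reach_set H1 i m. {u, Suc m} \<in> H2)"
proof
  assume "reach (H1 \<union> H2) i (Suc m)"
  then obtain u where u: "reach (H1 \<union> H2) i u" "up_edge (H1 \<union> H2) u (Suc m)"
    using assms(3) by (cases rule: rtranclp.cases) auto
  have "u \<le> m" using u(2) by (simp add: up_edge_def)
  have "{u, Suc m} \<notin> H1"
    using assms(1) by (auto simp: complete_edges_def doubleton_eq_iff)
  moreover have "reach H1 i u"
    using u(1)
  proof (rule reach_restrict)
    fix a b assume "a < b" "b \<le> u" "{a, b} \<in> H1 \<union> H2"
    moreover from this have "{a, b} \<notin> H2"
      using assms(2) \<open>u \<le> m\<close> by (auto simp: star_edges_def doubleton_eq_iff)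
    ultimately show "{a, b} \<in> H1" by blast
  qed
  ultimately show "\<exists>u\<in>reach_set H1 i m. {u, Suc m} \<in> H2"
    using u \<open>u \<le> m\<close> reach_le[OF u(1)] by (auto simp: up_edge_def reach_set_def)
next
  assume "\<exists>u\<in>reach_set H1 i m. {u, Suc m} \<in> H2"
  then obtain u where "u \<le> m" "reach H1 i u" "{u, Suc m} \<in> H2"
    by (auto simp: reach_set_def)
  then have "reach (H1 \<union> H2) i u" "up_edge (H1 \<union> H2) u (Suc m)"
    by (auto simp: up_edge_def intro: reach_mono)
  then show "reach (H1 \<union> H2) i (Suc m)" by (rule rtranclp.rtrancl_into_rtrancl)
qed

lemma reach_set_Un_star:
  assumes "H2 \<subseteq> star_edges m (Suc m)"
  shows "reach_set (H1 \<union> H2) i m = reach_set H1 i m"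
proof -
  have "reach (H1 \<union> H2) i v \<longleftrightarrow> reach H1 i v" if "v \<le> m" for v
  proof
    assume "reach (H1 \<union> H2) i v"
    then show "reach H1 i v"
    proof (rule reach_restrict)
      fix a b assume "a < b" "b \<le> v" "{a, b} \<in> H1 \<union> H2"
      moreover from this have "{a, b} \<notin> H2"
        using assms that by (auto simp: star_edges_def doubleton_eq_iff)
      ultimately show "{a, b} \<in> H1" by blast
    qed
  qed (erule reach_mono, simp)
  then show ?thesis by (auto simp: reach_set_def)
qed

lemma reach_set_Suc:
  assumes "i \<le> Suc m"
  shows "reach_set E i (Suc m) =
    (if reach E i (Suc m) then insert (Suc m) (reach_set E i m) else reach_set E i m)"
  using assms by (auto simp: reach_set_def le_Suc_eq)

subsection \<open>Random subgraphs\<close>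

lemma set_pmf_random_subgraph: "set_pmf (random_subgraph E p) \<subseteq> Pow E"
  by (auto simp: random_subgraph_def)

lemma finite_set_pmf_random_subgraph [simp]:
  "finite E \<Longrightarrow> finite (set_pmf (random_subgraph E p))"
  using set_pmf_random_subgraph by (metis finite_Pow_iff finite_subset)

text \<open>This is the coupling: intersecting one random subgraph of \<open>E\<close> with
  \<open>F\<close> samples the random subgraph of \<open>F\<close>.\<close>

lemma random_subgraph_subset:
  assumes "finite E" "F \<subseteq> E"
  shows "random_subgraph F p = map_pmf (\<lambda>H. H \<inter> F) (random_subgraph E p)"
  using assms
  by (auto simp: random_subgraph_def Pi_pmf_subset[OF assms] pmf.map_comp intro!: map_pmf_cong)

lemma random_subgraph_Un:
  assumes "finite A" "finite B" "A \<inter> B = {}"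
  shows "random_subgraph (A \<union> B) p =
    bind_pmf (random_subgraph A p) (\<lambda>H1. map_pmf (\<lambda>H2. H1 \<union> H2) (random_subgraph B p))"
proof -
  have "random_subgraph (A \<union> B) p =
      map_pmf (\<lambda>(H1, H2). H1 \<union> H2) (pair_pmf (random_subgraph A p) (random_subgraph B p))"
    using assms(3)
    by (auto simp: random_subgraph_def Pi_pmf_union[OF assms] pmf.map_comp
        map_pair[symmetric] intro!: map_pmf_cong)
  then show ?thesis
    by (simp add: pair_pmf_def map_bind_pmf map_pmf_def bind_assoc_pmf bind_return_pmf)
qed

text \<open>Fubini for independent choices on disjoint edge sets; it permits conditioning on the
  explored part \<open>H1\<close>.\<close>

lemma expectation_random_subgraph_Un:
  fixes h :: "nat set set \<Rightarrow> real"
  assumes "finite A" "finite B" "A \<inter> B = {}"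
  shows "measure_pmf.expectation (random_subgraph (A \<union> B) p) h =
    measure_pmf.expectation (random_subgraph A p)
      (\<lambda>H1. measure_pmf.expectation (random_subgraph B p) (\<lambda>H2. h (H1 \<union> H2)))"
proof -
  let ?S = "set_pmf (random_subgraph A p)"
  have "finite ?S" using assms by simp
  then show ?thesis
    unfolding random_subgraph_Un[OF assms]
    using assms by (subst pmf_expectation_bind[of ?S])
      (auto simp: integral_measure_pmf[of ?S] intro!: sum.cong)
qed

lemma prob_random_subgraph_avoid:
  assumes "finite E" "S \<subseteq> E" "0 \<le> p" "p \<le> 1"
  shows "measure_pmf.prob (random_subgraph E p) {H. H \<inter> S = {}} = (1 - p) ^ card S"
proof -
  have "finite S" using assms finite_subset by blast
  \<comment> \<open>Projecting to \<open>S\<close> turns the event into the single outcome that no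
    edge is kept.\<close>
  have "measure_pmf.prob (random_subgraph E p) {H. H \<inter> S = {}} =
      measure_pmf.prob (random_subgraph S p) {{}}"
    by (simp add: random_subgraph_subset[OF assms(1,2)] vimage_def)
  also have "\<dots> = measure_pmf.prob (Pi_pmf S False (\<lambda>_. bernoulli_pmf p)) (Pi S (\<lambda>_. {False}))"
    unfolding random_subgraph_def measure_map_pmf
    by (rule arg_cong[where f = "measure_pmf.prob _"]) (auto simp: vimage_def Pi_def)
  also have "\<dots> = (1 - p) ^ card S"
    using assms \<open>finite S\<close> by (simp add: measure_Pi_pmf_Pi measure_pmf_single)
  finally show ?thesis .
qed

lemma integral_random_subgraph_mono:
  fixes f g :: "nat set set \<Rightarrow> real"
  assumes "finite E" "\<And>H. H \<subseteq> E \<Longrightarrow> f H \<le> g H"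
  shows "measure_pmf.expectation (random_subgraph E p) f \<le>
    measure_pmf.expectation (random_subgraph E p) g"
  using assms set_pmf_random_subgraph[of E p]
  by (intro integral_mono_AE integrable_measure_pmf_finite) (auto simp: AE_measure_pmf_iff)

lemma prob_star_avoid:
  assumes "S \<subseteq> {1..m}" "0 \<le> p" "p \<le> 1"
  shows "measure_pmf.prob (random_subgraph (star_edges m (Suc m)) p)
    {H. \<forall>u\<in>S. {u, Suc m} \<notin> H} = (1 - p) ^ card S"
proof -
  let ?S = "(\<lambda>u. {u, Suc m}) ` S"
  have "card ?S = card S"
    by (rule card_image) (use assms in \<open>auto simp: inj_on_def doubleton_eq_iff\<close>)
  moreover have "?S \<subseteq> star_edges m (Suc m)" using assms by (auto simp: star_edges_def)
  moreover have "{H. \<forall>u\<in>S. {u, Suc m} \<notin> H} = {H. H \<inter> ?S = {}}" by auto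
  ultimately show ?thesis using prob_random_subgraph_avoid[of "star_edges m (Suc m)" ?S p] assms
    by simp
qed

subsection \<open>Growth of the set of reachable vertices\<close>

text \<open>The numerator is the chance that a new vertex misses all \<open>r\<close> reachable
  ones. Alone it contracts only by \<open>1 - p^2\<close> at \<open>r = 1\<close>; dividing by
  \<open>r\<close> gives a rate linear in \<open>p\<close> for every \<open>r\<close>.\<close>

definition potential :: "real \<Rightarrow> nat \<Rightarrow> real" where
  "potential p r = (1 - p) ^ r / real r"

text \<open>With \<open>q = (1 - p)^r\<close>, passing from \<open>r\<close> to \<open>r + 1\<close>
  lowers the potential by the fraction \<open>(1 + r * p) / (r + 1)\<close> of itself, and this
  happens with probability \<open>1 - q\<close>. The product of the two is at least
  \<open>p / 2\<close>.\<close>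

lemma potential_step:
  fixes p :: real
  assumes "0 \<le> p" "p \<le> 1" "r > 0"
  shows "(1 - (1 - p) ^ r) * potential p (Suc r) + (1 - p) ^ r * potential p r
    \<le> (1 - p / 2) * potential p r"
proof -
  define q where "q = (1 - p) ^ r"
  have q: "0 \<le> q" "q \<le> 1" using assms by (auto simp: q_def power_le_one)
  \<comment> \<open>Bernoulli's inequality is applied to \<open>1 + p\<close> because
    \<open>(1 - p) * (1 + p)\<close> is at most 1, which bounds \<open>q * (1 + r * p)\<close> by
    1.\<close>
  have "1 + real r * p \<le> (1 + p) ^ r"
    using Bernoulli_inequality[of p r] assms by simp
  then have "q * (1 + real r * p) \<le> q * (1 + p) ^ r" using q by (intro mult_left_mono)
  also have "\<dots> = ((1 - p) * (1 + p)) ^ r" by (simp add: q_def power_mult_distrib)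
  also have "\<dots> \<le> 1"
    using assms by (intro power_le_one) (auto simp: algebra_simps mult_le_one)
  finally have 1: "q * (1 + real r * p) \<le> 1" .
  \<comment> \<open>The loss of the factor 2 comes from \<open>r + 1 \<le> 2 * r\<close>.\<close>
  have "p / 2 * (real r + 1) \<le> real r * p"
    using assms mult_left_mono[of 1 "real r" p] by (simp add: field_simps)
  also have "\<dots> \<le> (1 - q) * (1 + real r * p)" using 1 by (simp add: algebra_simps)
  finally have 2: "p / 2 \<le> (1 - q) * ((1 + real r * p) / (real r + 1))"
    by (simp add: field_simps)
  have "potential p r - potential p (Suc r) = q / real r * ((1 + real r * p) / (real r + 1))"
    using assms by (simp add: potential_def q_def field_simps)
  then have "(1 - q) * (potential p r - potential p (Suc r)) =
      q / real r * ((1 - q) * ((1 + real r * p) / (real r + 1)))" by simp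
  moreover have "q / real r * ((1 - q) * ((1 + real r * p) / (real r + 1))) \<ge> q / real r * (p / 2)"
    using 2 q by (intro mult_left_mono) auto
  ultimately have "(1 - q) * (potential p r - potential p (Suc r)) \<ge> p / 2 * potential p r"
    by (simp add: potential_def q_def mult.commute)
  then show ?thesis by (simp add: q_def[symmetric] algebra_simps)
qed

lemma expectation_potential_star:
  assumes "H1 \<subseteq> complete_edges m" "1 \<le> i" "i \<le> m" "0 \<le> p" "p \<le> 1"
  shows "measure_pmf.expectation (random_subgraph (star_edges m (Suc m)) p)
      (\<lambda>H2. potential p (card (reach_set (H1 \<union> H2) i (Suc m))))
    \<le> (1 - p / 2) * potential p (card (reach_set H1 i m))"
proof -
  let ?R = "reach_set H1 i m" and ?P = "random_subgraph (star_edges m (Suc m)) p"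
  let ?A = "{H. \<forall>u\<in>?R. {u, Suc m} \<notin> H}"
  let ?a = "potential p (card ?R)" and ?b = "potential p (Suc (card ?R))"
  have notin: "Suc m \<notin> ?R" by (simp add: reach_set_def)
  \<comment> \<open>The new potential is affine in the indicator of a missed vertex, so its
    expectation needs only the probability of \<open>?A\<close>.\<close>
  have step: "potential p (card (reach_set (H1 \<union> H2) i (Suc m))) = ?b + (?a - ?b) * indicator ?A H2"
    if "H2 \<subseteq> star_edges m (Suc m)" for H2
    using that assms(3) notin
    by (simp add: reach_set_Suc reach_Suc_iff[OF assms(1)] reach_set_Un_star)
  have "measure_pmf.expectation ?P (\<lambda>H2. potential p (card (reach_set (H1 \<union> H2) i (Suc m))))
      = measure_pmf.expectation ?P (\<lambda>H2. ?b + (?a - ?b) * indicator ?A H2)"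
    using set_pmf_random_subgraph[of "star_edges m (Suc m)" p]
    by (intro integral_cong_AE) (auto simp: AE_measure_pmf_iff step)
  also have "\<dots> = ?b + (?a - ?b) * measure_pmf.prob ?P ?A"
    by (subst Bochner_Integration.integral_add)
      (auto intro!: integrable_measure_pmf_finite)
  also have "measure_pmf.prob ?P ?A = (1 - p) ^ card ?R"
    using assms by (intro prob_star_avoid) (auto simp: reach_set_def)
  also have "?b + (?a - ?b) * (1 - p) ^ card ?R \<le> (1 - p / 2) * ?a"
    using potential_step[of p "card ?R"] assms card_reach_set_pos[of i m H1]
    by (simp add: algebra_simps)
  finally show ?thesis .
qed

lemma expectation_potential_le:
  assumes "1 \<le> i" "0 \<le> p" "p \<le> 1"
  shows "measure_pmf.expectation (random_subgraph (complete_edges (i + t)) p)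
      (\<lambda>H. potential p (card (reach_set H i (i + t)))) \<le> (1 - p / 2) ^ t"
proof (induction t)
  case 0
  \<comment> \<open>Initially only \<open>i\<close> is reached, and the potential is
    \<open>1 - p\<close>, at most 1.\<close>
  have "reach_set H i i = {i}" for H by (auto simp: reach_set_def)
  then show ?case using assms by (simp add: potential_def)
next
  case (Suc t)
  let ?m = "i + t"
  let ?K = "random_subgraph (complete_edges ?m) p"
  have "measure_pmf.expectation (random_subgraph (complete_edges (Suc ?m)) p)
      (\<lambda>H. potential p (card (reach_set H i (Suc ?m)))) =
    measure_pmf.expectation ?K
      (\<lambda>H1. measure_pmf.expectation (random_subgraph (star_edges ?m (Suc ?m)) p)
        (\<lambda>H2. potential p (card (reach_set (H1 \<union> H2) i (Suc ?m)))))"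
    unfolding complete_edges_Suc
    by (rule expectation_random_subgraph_Un) (auto simp: complete_star_disjoint)
  also have "\<dots> \<le> measure_pmf.expectation ?K
      (\<lambda>H1. (1 - p / 2) * potential p (card (reach_set H1 i ?m)))"
    using assms by (intro integral_random_subgraph_mono expectation_potential_star) auto
  also have "\<dots> = (1 - p / 2) * measure_pmf.expectation ?K
      (\<lambda>H1. potential p (card (reach_set H1 i ?m)))" by simp
  also have "\<dots> \<le> (1 - p / 2) * (1 - p / 2) ^ t"
    using assms Suc.IH by (intro mult_left_mono) auto
  finally show ?case by simp
qed

section \<open>Failure probabilities at a single vertex\<close>

lemma prob_random_subgraph_proj:
  assumes "finite E" "F \<subseteq> E" "\<And>H. H \<subseteq> E \<Longrightarrow> H \<in> X \<longleftrightarrow> H \<inter> F \<in> X"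
  shows "measure_pmf.prob (random_subgraph E p) X = measure_pmf.prob (random_subgraph F p) X"
  unfolding random_subgraph_subset[OF assms(1,2)] measure_map_pmf
  using set_pmf_random_subgraph[of E p] assms(3)
  by (intro measure_pmf.finite_measure_eq_AE) (auto simp: AE_measure_pmf_iff)

lemma prob_not_reach_le:
  assumes "1 \<le> i" "i + t < n" "0 \<le> p" "p \<le> 1"
  shows "measure_pmf.prob (random_subgraph (complete_edges n) p) {H. \<not> reach H i (Suc (i + t))}
    \<le> real n * (1 - p / 2) ^ t"
proof -
  let ?m = "i + t"
  let ?K = "random_subgraph (complete_edges ?m) p"
  let ?S = "random_subgraph (star_edges ?m (Suc ?m)) p"
  let ?X = "{H. \<not> reach H i (Suc ?m)}"
  \<comment> \<open>Edges at vertices beyond \<open>Suc ?m\<close> cannot lie on an upward path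
    ending there.\<close>
  have "measure_pmf.prob (random_subgraph (complete_edges n) p) ?X =
      measure_pmf.prob (random_subgraph (complete_edges (Suc ?m)) p) ?X"
  proof (rule prob_random_subgraph_proj)
    fix H assume H: "H \<subseteq> complete_edges n"
    have "reach (H \<inter> complete_edges (Suc ?m)) i (Suc ?m)" if "reach H i (Suc ?m)"
      using that by (rule reach_restrict) (use assms in \<open>auto intro!: complete_edges_memI\<close>)
    then show "H \<in> ?X \<longleftrightarrow> H \<inter> complete_edges (Suc ?m) \<in> ?X"
      by (auto intro: reach_mono)
  qed (use assms in \<open>auto intro!: complete_edges_mono\<close>)
  also have "\<dots> = measure_pmf.expectation (random_subgraph (complete_edges (Suc ?m)) p) (indicator ?X)"
    by simp
  also have "\<dots> = measure_pmf.expectation ?K (\<lambda>H1. measure_pmf.expectation ?S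
        (\<lambda>H2. indicator ?X (H1 \<union> H2)))"
    unfolding complete_edges_Suc
    by (rule expectation_random_subgraph_Un) (auto simp: complete_star_disjoint)
  also have "\<dots> \<le> measure_pmf.expectation ?K
      (\<lambda>H1. real n * potential p (card (reach_set H1 i ?m)))"
  proof (rule integral_random_subgraph_mono)
    fix H1 assume H1: "H1 \<subseteq> complete_edges ?m"
    let ?R = "reach_set H1 i ?m"
    let ?A = "{H. \<forall>u\<in>?R. {u, Suc ?m} \<notin> H}"
    have "H1 \<union> H2 \<in> ?X \<longleftrightarrow> H2 \<in> ?A" if "H2 \<subseteq> star_edges ?m (Suc ?m)" for H2
      using reach_Suc_iff[OF H1 that, of i] by simp
    then have "measure_pmf.expectation ?S (\<lambda>H2. indicator ?X (H1 \<union> H2) :: real) =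
        measure_pmf.expectation ?S (indicator ?A)"
      using set_pmf_random_subgraph[of "star_edges ?m (Suc ?m)" p]
      by (intro integral_cong_AE)
        (auto simp: AE_measure_pmf_iff indicator_def simp del: mem_Collect_eq)
    also have "\<dots> = (1 - p) ^ card ?R"
      using assms by (simp, intro prob_star_avoid) (auto simp: reach_set_def)
    \<comment> \<open>Undoing the division by the number of reachable vertices costs the factor
      \<open>n\<close>.\<close>
    also have "\<dots> = real (card ?R) * potential p (card ?R)"
      using card_reach_set_pos[of i ?m H1] by (auto simp: potential_def card_gt_0_iff)
    also have "\<dots> \<le> real n * potential p (card ?R)"
      using card_reach_set_le[of i H1 ?m] assms by (intro mult_right_mono) (auto simp: potential_def)
    finally show "measure_pmf.expectation ?S (\<lambda>H2. indicator ?X (H1 \<union> H2)) \<le>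
        real n * potential p (card ?R)" .
  qed simp
  also have "\<dots> = real n * measure_pmf.expectation ?K (\<lambda>H1. potential p (card (reach_set H1 i ?m)))"
    by simp
  also have "\<dots> \<le> real n * (1 - p / 2) ^ t"
    using assms by (intro mult_left_mono expectation_potential_le) auto
  finally show ?thesis .
qed

text \<open>Since \<open>k < m\<close>, the window starts at a positive vertex and offers exactly
  \<open>k\<close> independent edges.\<close>

lemma prob_no_back_edge:
  assumes "k < m" "m \<le> n" "0 \<le> p" "p \<le> 1"
  shows "measure_pmf.prob (random_subgraph (complete_edges n) p) {H. \<forall>v\<in>{m - k..<m}. {v, m} \<notin> H}
    = (1 - p) ^ k"
proof -
  let ?S = "(\<lambda>v. {v, m}) ` {m - k..<m}"
  have "card ?S = card {m - k..<m}"
    by (rule card_image) (auto simp: inj_on_def doubleton_eq_iff)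
  moreover have "?S \<subseteq> complete_edges n" using assms by (auto intro!: complete_edges_memI)
  moreover have "{H. \<forall>v\<in>{m - k..<m}. {v, m} \<notin> H} = {H. H \<inter> ?S = {}}" by auto
  ultimately show ?thesis using prob_random_subgraph_avoid[of "complete_edges n" ?S p] assms
    by simp
qed

subsection \<open>The band graph\<close>

lemma band_edges_subset: "band_edges n w \<subseteq> complete_edges n"
  by (auto simp: band_edges_def complete_edges_def)

lemma card_band_edges_le:
  assumes "w \<ge> 0"
  shows "int (card (band_edges n w)) \<le> int n * w"
proof -
  \<comment> \<open>An edge is determined by its lower endpoint and its length.\<close>
  have "band_edges n w \<subseteq> (\<lambda>(i, d). {i, i + d}) ` ({1..n} \<times> {1..nat w})"
  proof
    fix e assume "e \<in> band_edges n w"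
    then obtain i j where e: "e = {i, j}" "i \<in> {1..n}" "j \<in> {1..n}" "i \<noteq> j" "\<bar>int i - int j\<bar> \<le> w"
      by (auto simp: band_edges_def)
    then have "e = {min i j, min i j + (max i j - min i j)}"
      "min i j \<in> {1..n}" "max i j - min i j \<in> {1..nat w}"
      by (auto simp: min_def max_def)
    then show "e \<in> (\<lambda>(i, d). {i, i + d}) ` ({1..n} \<times> {1..nat w})" by blast
  qed
  then have "card (band_edges n w) \<le> card ({1..n} \<times> {1..nat w})"
    by (rule surj_card_le[rotated]) simp
  then have "int (card (band_edges n w)) \<le> int (n * nat w)"
    by (simp only: card_cartesian_product card_atLeastAtMost zle_int) simp
  then show ?thesis using assms by simp
qed

lemma band_edges_memI:
  assumes "1 \<le> u" "u < v" "v \<le> n" "int v - int u \<le> w"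
  shows "{u, v} \<in> band_edges n w"
  unfolding band_edges_def using assms by (intro CollectI exI[of _ u] exI[of _ v]) auto

lemma reach_band_if_short:
  assumes "reach H i j" "int j - int i \<le> w" "1 \<le> i" "j \<le> n"
  shows "reach (H \<inter> band_edges n w) i j"
  using assms(1) by (rule reach_restrict) (use assms(2-) in \<open>auto intro!: band_edges_memI\<close>)

text \<open>Strong induction on the target: vertices up to \<open>i + W\<close> are close enough for
  the band to lose no path, and each later one hangs on a vertex at most \<open>k\<close> below it
  that is already reached.\<close>

lemma reach_band_chain:
  assumes near: "\<And>m. m \<in> {i + k<..i + W} \<Longrightarrow> reach H i m"
    and backward: "\<And>m. m \<in> {i + W<..j} \<Longrightarrow> \<exists>v\<in>{m - k..<m}. {v, m} \<in> H"
    and "1 \<le> i" "2 * k \<le> W" "j \<le> n" "i + W < j"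
  shows "reach (H \<inter> band_edges n (int W)) i j"
proof -
  have "reach (H \<inter> band_edges n (int W)) i m" if "i + k < m" "m \<le> j" for m
    using that
  proof (induction m rule: less_induct)
    case (less m)
    show ?case
    proof (cases "m \<le> i + W")
      case True
      with less.prems assms show ?thesis by (intro reach_band_if_short near) auto
    next
      case False
      with less.prems have "\<exists>v\<in>{m - k..<m}. {v, m} \<in> H" by (intro backward) auto
      then obtain v where v: "m - k \<le> v" "v < m" "{v, m} \<in> H" by auto
      \<comment> \<open>From \<open>m > i + W\<close> and \<open>W \<ge> 2 * k\<close>, stepping
        back by at most \<open>k\<close> stays above \<open>i + k\<close>, where the induction
        hypothesis applies.\<close>
      with False assms(4) have "i + k < v" by linarith
      with less v have "reach (H \<inter> band_edges n (int W)) i v" by auto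
      moreover have "up_edge (H \<inter> band_edges n (int W)) v m"
        using v \<open>i + k < v\<close> less.prems assms(4,5) by (auto simp: up_edge_def intro!: band_edges_memI)
      ultimately show ?thesis by (rule rtranclp.rtrancl_into_rtrancl)
    qed
  qed
  then show ?thesis using assms by auto
qed

lemma prob_not_reach_band_le:
  assumes "1 \<le> i" "i + W < j" "j \<le> n" "2 * k \<le> W" "0 \<le> p" "p \<le> 1"
  shows "measure_pmf.prob (random_subgraph (complete_edges n) p)
      {H. \<not> reach (H \<inter> band_edges n (int W)) i j} \<le> real n * (real n * (1 - p / 2) ^ k)"
proof -
  let ?P = "random_subgraph (complete_edges n) p"
  let ?b = "real n * (1 - p / 2) ^ k"
  \<comment> \<open>Bad events: below the threshold \<open>m\<close> is unreachable in the full
    random graph; above it \<open>m\<close> has no edge to the preceding \<open>k\<close>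
    vertices.\<close>
  define B where "B m = (if m \<le> i + W then {H. \<not> reach H i m}
    else {H. \<forall>v\<in>{m - k..<m}. {v, m} \<notin> H})" for m
  have B: "measure_pmf.prob ?P (B m) \<le> ?b" if "m \<in> {i + k<..j}" for m
  proof (cases "m \<le> i + W")
    case True
    \<comment> \<open>The exploration bound speaks of \<open>Suc (i + t)\<close>;
      \<open>m > i + k\<close> gives \<open>t \<ge> k\<close>.\<close>
    define t where "t = m - Suc i"
    have t: "m = Suc (i + t)" "k \<le> t" using that by (auto simp: t_def)
    have "measure_pmf.prob ?P (B m) \<le> real n * (1 - p / 2) ^ t"
      using prob_not_reach_le[of i t n p] t True that assms by (simp add: B_def)
    also have "\<dots> \<le> ?b"
      using assms t by (intro mult_left_mono power_decreasing) auto
    finally show ?thesis .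
  next
    case False
    have "measure_pmf.prob ?P (B m) = (1 - p) ^ k"
      using False that assms prob_no_back_edge[of k m n p] by (simp add: B_def)
    also have "\<dots> \<le> 1 * (1 - p / 2) ^ k"
      using assms by (auto intro!: power_mono)
    also have "\<dots> \<le> ?b"
      using assms by (intro mult_right_mono) auto
    finally show ?thesis .
  qed
  have "{H. \<not> reach (H \<inter> band_edges n (int W)) i j} \<subseteq> (\<Union>m\<in>{i + k<..j}. B m)"
  proof
    fix H assume H: "H \<in> {H. \<not> reach (H \<inter> band_edges n (int W)) i j}"
    show "H \<in> (\<Union>m\<in>{i + k<..j}. B m)"
    proof (rule ccontr)
      assume *: "H \<notin> (\<Union>m\<in>{i + k<..j}. B m)"
      have "reach (H \<inter> band_edges n (int W)) i j"
      proof (rule reach_band_chain)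
        fix m assume "m \<in> {i + k<..i + W}"
        with * assms have "H \<notin> B m" "m \<le> i + W" by auto
        then show "reach H i m" by (simp add: B_def)
      next
        fix m assume "m \<in> {i + W<..j}"
        with * assms have "H \<notin> B m" "\<not> m \<le> i + W" by auto
        then show "\<exists>v\<in>{m - k..<m}. {v, m} \<in> H" by (simp add: B_def)
      qed (use assms in auto)
      with H show False by simp
    qed
  qed
  then have "measure_pmf.prob ?P {H. \<not> reach (H \<inter> band_edges n (int W)) i j}
      \<le> measure_pmf.prob ?P (\<Union>m\<in>{i + k<..j}. B m)"
    by (intro measure_pmf.finite_measure_mono) auto
  also have "\<dots> \<le> (\<Sum>m\<in>{i + k<..j}. measure_pmf.prob ?P (B m))"
    by (intro measure_pmf.finite_measure_subadditive_finite) auto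
  also have "\<dots> \<le> (\<Sum>m\<in>{i + k<..j}. ?b)" by (intro sum_mono B)
  also have "\<dots> = real (card {i + k<..j}) * ?b" by simp
  also have "\<dots> \<le> real n * ?b" using assms by (intro mult_right_mono) auto
  finally show ?thesis .
qed

section \<open>Comparison of deficiencies\<close>

text \<open>Pairs at distance at most \<open>W\<close> lose no connection, so only longer pairs can
  add to the deficiency; all those disconnected in the band are counted.\<close>

lemma deficiency_band_le:
  "real (deficiency n (H \<inter> band_edges n (int W))) \<le> real (deficiency n H) +
    (\<Sum>(i, j) \<in> {(i, j). i \<in> {1..n} \<and> j \<in> {1..n} \<and> i + W < j}.
      indicator {H. \<not> reach (H \<inter> band_edges n (int W)) i j} H)"
proof -
  let ?B = "H \<inter> band_edges n (int W)"
  let ?D = "\<lambda>E. {(i, j). i \<in> {1..n} \<and> j \<in> {1..n} \<and> i < j \<and> \<not> reach E i j}"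
  let ?L = "{(i, j). i \<in> {1..n} \<and> j \<in> {1..n} \<and> i + W < j}"
  let ?N = "{(i, j). (i, j) \<in> ?L \<and> \<not> reach ?B i j}"
  have fin: "finite X" if "X \<subseteq> {1..n} \<times> {1..n}" for X :: "(nat \<times> nat) set"
    using that finite_subset by blast
  have finL: "finite ?L" by (rule fin) auto
  have "reach ?B i j" if "reach H i j" "1 \<le> i" "j \<le> n" "\<not> i + W < j" for i j
    using that by (intro reach_band_if_short) auto
  then have "?D ?B \<subseteq> ?D H \<union> ?N" by auto
  then have "card (?D ?B) \<le> card (?D H \<union> ?N)"
    by (intro card_mono fin) auto
  also have "\<dots> \<le> card (?D H) + card ?N" by (rule card_Un_le)
  finally have "real (deficiency n ?B) \<le> real (deficiency n H) + real (card ?N)"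
    unfolding deficiency_altdef by linarith
  also have "real (card ?N) =
      (\<Sum>x\<in>?L. indicator {H. \<not> reach (H \<inter> band_edges n (int W)) (fst x) (snd x)} H)"
  proof -
    have "real (card ?N) = (\<Sum>x\<in>?L. if x \<in> ?N then 1 else 0)"
      using finL by (subst sum.inter_filter[symmetric]) (auto intro!: arg_cong[where f = card])
    then show ?thesis by (simp only:) (rule sum.cong, auto simp: indicator_def)
  qed
  finally show ?thesis by (simp add: case_prod_beta)
qed

text \<open>At most \<open>n^2\<close> long pairs, each failing with probability at most
  \<open>n^2 * (1 - p / 2)^k\<close>, give the factor \<open>n^4\<close>.\<close>

lemma expected_deficiency_band_le:
  assumes "2 * k \<le> W" "0 \<le> p" "p \<le> 1"
  shows "expected_deficiency n (band_edges n (int W)) p \<le>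
    optimal_deficiency n p + real n ^ 4 * (1 - p / 2) ^ k"
proof -
  let ?P = "random_subgraph (complete_edges n) p"
  let ?L = "{(i, j). i \<in> {1..n} \<and> j \<in> {1..n} \<and> i + W < j}"
  let ?X = "\<lambda>x. {H. \<not> reach (H \<inter> band_edges n (int W)) (fst x) (snd x)}"
  let ?b = "real n * (real n * (1 - p / 2) ^ k)"
  have integrable: "integrable (measure_pmf ?P) f" for f :: "_ \<Rightarrow> real"
    by (rule integrable_measure_pmf_finite) simp
  have L: "?L \<subseteq> {1..n} \<times> {1..n}" by auto
  then have finL: "finite ?L" by (rule finite_subset) simp
  have "expected_deficiency n (band_edges n (int W)) p =
      measure_pmf.expectation ?P (\<lambda>H. real (deficiency n (H \<inter> band_edges n (int W))))"
    by (simp add: expected_deficiency_def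
        random_subgraph_subset[OF finite_complete_edges band_edges_subset])
  also have "\<dots> \<le> measure_pmf.expectation ?P
      (\<lambda>H. real (deficiency n H) + (\<Sum>x\<in>?L. indicator (?X x) H))"
    using deficiency_band_le[of n _ W]
    by (intro integral_random_subgraph_mono) (simp_all add: case_prod_beta)
  also have "\<dots> = optimal_deficiency n p + (\<Sum>x\<in>?L. measure_pmf.prob ?P (?X x))"
    by (simp add: Bochner_Integration.integral_add integrable Bochner_Integration.integral_sum
        optimal_deficiency_def expected_deficiency_def)
  also have "(\<Sum>x\<in>?L. measure_pmf.prob ?P (?X x)) \<le> (\<Sum>x\<in>?L. ?b)"
  proof (rule sum_mono)
    fix x assume "x \<in> ?L"
    then show "measure_pmf.prob ?P (?X x) \<le> ?b"
      using assms by (intro prob_not_reach_band_le) auto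
  qed
  also have "\<dots> = real (card ?L) * ?b" by simp
  also have "\<dots> \<le> real (n * n) * ?b"
    using card_mono[OF _ L] assms
    by (intro mult_right_mono) (auto simp: card_cartesian_product simp flip: of_nat_mult)
  finally show ?thesis by (simp add: power4_eq_xxxx mult.assoc)
qed

section \<open>Choice of the constant\<close>

lemma power_one_minus_le_exp:
  fixes x :: real
  assumes "x \<le> 1"
  shows "(1 - x) ^ k \<le> exp (- (real k * x))"
proof -
  have "(1 - x) ^ k \<le> exp (- x) ^ k"
    using assms exp_ge_add_one_self[of "- x"] by (intro power_mono) auto
  then show ?thesis by (simp add: exp_of_nat_mult[symmetric])
qed

theorem lemma4p2:
  shows "\<exists>c\<^sub>0::real. c\<^sub>0 > 0 \<and>
    (\<forall>c\<^sub>6::real. c\<^sub>6 \<ge> c\<^sub>0 \<longrightarrow>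
      (\<forall>(\<psi>::real) (n::nat). 0 < \<psi> \<and> \<psi> < 1 \<and> real n \<ge> 1 / \<psi> \<longrightarrow>
        (let w = \<lceil>(c\<^sub>6 / \<psi>) * ln (real n)\<rceil>; G = band_edges n w in
          int (card G) \<le> int n * w \<and>
          expected_deficiency n G \<psi> \<le> optimal_deficiency n \<psi> + 1)))"
\<comment> \<open>The error is at most 1 once \<open>k * (p / 2) \<ge> 4 * ln n\<close>. As
  \<open>k\<close> is about \<open>x / 2\<close>, the left side is about
  \<open>c * ln n / 4\<close>, so 40 leaves room for rounding.\<close>
proof (intro exI[of _ 40] conjI allI impI)
  fix c p :: real and n :: nat
  assume c: "c \<ge> 40" and p: "0 < p \<and> p < 1 \<and> real n \<ge> 1 / p"
  define x where "x = (c / p) * ln (real n)"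
  define W where "W = nat \<lceil>x\<rceil>"
  define k where "k = W div 2"
  have "1 < 1 / p" using p by simp
  with p have "real n > 1" by linarith
  then have n: "real n \<ge> 2" by simp
  \<comment> \<open>This lower bound absorbs the rounding loss of at most \<open>p / 4\<close> in
    \<open>k * (p / 2)\<close>.\<close>
  have ln2: "ln (real n) \<ge> 1 / 2"
  proof -
    have "1 - ln (real n) \<le> 1 / real n" "1 / real n \<le> 1 / 2"
      using n ln_le_minus_one[of "1 / real n"] by (auto simp: ln_div field_simps)
    then show ?thesis by linarith
  qed
  have "c * ln (real n) \<ge> 40 * ln (real n)" using c ln2 by (intro mult_right_mono) auto
  moreover have xp: "x * p = c * ln (real n)" using p by (simp add: x_def)
  ultimately have xp40: "x * p \<ge> 40 * ln (real n)" by simp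
  have "x > 0" using c p ln2 by (simp add: x_def)
  \<comment> \<open>Positivity of \<open>x\<close> ensures that the conversion by \<open>nat\<close>
    does not truncate.\<close>
  then have W: "\<lceil>x\<rceil> = int W" "x \<le> real W" by (auto simp: W_def)
  have "W \<le> 2 * k + 1" by (simp add: k_def)
  then have "real W \<le> real (2 * k + 1)" by (simp only: of_nat_le_iff)
  then have "real k \<ge> (real W - 1) / 2" by simp
  then have "real k * p \<ge> (x - 1) / 2 * p" using p W by (intro mult_right_mono) auto
  also have "(x - 1) / 2 * p = x * p / 2 - p / 2" by (simp add: field_simps)
  finally have "real k * (p / 2) \<ge> 4 * ln (real n)" using xp40 ln2 p by simp
  moreover have "(1 - p / 2) ^ k \<le> exp (- (real k * (p / 2)))"
    using p by (intro power_one_minus_le_exp) auto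
  ultimately have "(1 - p / 2) ^ k \<le> exp (- (4 * ln (real n)))"
    by (meson exp_le_cancel_iff neg_le_iff_le order_trans)
  also have "\<dots> = 1 / real n ^ 4"
    using n exp_of_nat_mult[of 4 "ln (real n)"] by (simp add: exp_minus field_simps)
  finally have "real n ^ 4 * (1 - p / 2) ^ k \<le> 1" using n by (simp add: field_simps)
  moreover have "expected_deficiency n (band_edges n (int W)) p \<le>
      optimal_deficiency n p + real n ^ 4 * (1 - p / 2) ^ k"
    using p by (intro expected_deficiency_band_le) (auto simp: k_def)
  ultimately have "expected_deficiency n (band_edges n \<lceil>x\<rceil>) p \<le> optimal_deficiency n p + 1"
    using W by simp
  moreover have "int (card (band_edges n \<lceil>x\<rceil>)) \<le> int n * \<lceil>x\<rceil>"
    using W by (intro card_band_edges_le) auto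
  ultimately show "let w = \<lceil>(c / p) * ln (real n)\<rceil>; G = band_edges n w in
      int (card G) \<le> int n * w \<and> expected_deficiency n G p \<le> optimal_deficiency n p + 1"
    by (simp add: Let_def x_def)
qed simp

end
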